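(* Let $\bar X=\mathbb{C}P^{n_1}\times\dots\times\mathbb{C}P^{n_l}$, let $1\le a\le l$ and $\xi\in N_\mathbb{R}$. Then the unique parameterized $(n_a+1)$-marked, genus 0 tropical curve $(\Gamma_{n_a+1};E_1,\dots,E_{n_a+1};h_a)$ in $\bar X$ such that $h_a(V)=\xi$ and $h_a(E_j)=\xi+\mathbb{R}_{\ge0}v_{j,a}$ for $j=1,\dots,n_a+1$ is obtained by gluing the $n_a+1$ parameterized Maslov index two tropical discs $(\Gamma_1,E,h_{1,a}),\dots,(\Gamma_1,E,h_{n_a+1,a})$ with $h_{j,a}(V)=\xi$ and $h_{j,a}(E)=\xi+\mathbb{R}_{\ge0}v_{j,a}$, in the following sense: the map $h:(\Gamma_{n_a+1};E_1,\dots,E_{n_a+1})\to N_\mathbb{R}$ defined by $h|_{E_j}=h_{j,a}|_E$ for $j=1,\dots,n_a+1$ gives a parameterized $(n_a+1)$-marked, genus 0 tropical curve, which coincides with $(\Gamma_{n_a+1};E_1,\dots,E_{n_a+1};h_a)$.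
   Context: Fan of the product. $N=N_1\oplus\dots\oplus N_l$ with $N_a\cong\mathbb{Z}^{n_a}$, $N_\mathbb{R}=N\otimes\mathbb{R}$. For each $a$, $v_{1,a}=e_1,\dots,v_{n_a,a}=e_{n_a},\ v_{n_a+1,a}=-\sum_{j=1}^{n_a}e_j$ in $N_a$ (with $e_1,\dots,e_{n_a}$ the standard basis of $N_a$), regarded as vectors of $N$ sitting in the $a$-th summand. The set $\Sigma[1]$ of all $v_{j,a}$ is the set of primitive generators of the 1-dimensional cones of the fan of $\bar X$. Tropical curves. $\Gamma_m$ is the tree with exactly one ($m$-valent) vertex $V$, $m$ unbounded edges $E_1,\dots,E_m$ (half-lines emanating from $V$) and no bounded edges; $\Gamma_1$ is a half-line, with edge $E$ and vertex $V$. A parameterized $m$-marked, genus 0 tropical curve in $\bar X$ (of this type) is $(\Gamma_m;E_1,\dots,E_m;h)$ with $h:\Gamma_m\to N_\mathbb{R}$ a continuous embedding such that $h(E_k)=h(V)+\mathbb{R}_{\ge0}v(E_k)$ for some $v(E_k)\in\Sigma[1]$, $k=1,\dots,m$, and the balancing condition $\sum_{k=1}^mv(E_k)=0$ holds. A parameterized Maslov index two tropical disc in $\bar X$ is $(\Gamma_1,E,h)$ with $h:\Gamma_1\to N_\mathbb{R}$ an embedding such that $h(E)=h(V)+\mathbb{R}_{\ge0}v$ for some $v\in\Sigma[1]$. Uniqueness and equality of curves and discs are understood up to reparametrization of the unbounded edges; in the gluing, each $E_j$ is identified with $E$ so that the vertices correspond. *)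

theory Defs
  imports "HOL-Analysis.Analysis" "HOL-Library.Function_Algebras"
begin

(* Coordinate (b, i) is the i-th coordinate of the b-th summand, 1 \<le> b \<le> l, 1 \<le> i \<le> n b. *)
definition coords :: "nat \<Rightarrow> (nat \<Rightarrow> nat) \<Rightarrow> (nat \<times> nat) set" where
  "coords l n = (SIGMA b:{1..l}. {1..n b})"

(* As for Euclidean_space in HOL-Analysis, a vector is a total function vanishing outside
   its finite set of coordinates; the product topology then restricts to the usual one. *)
definition lattice_N :: "nat \<Rightarrow> (nat \<Rightarrow> nat) \<Rightarrow> (nat \<times> nat \<Rightarrow> int) set" where
  "lattice_N l n = {x. \<forall>c. c \<notin> coords l n \<longrightarrow> x c = 0}"

definition space_N :: "nat \<Rightarrow> (nat \<Rightarrow> nat) \<Rightarrow> (nat \<times> nat \<Rightarrow> real) set" where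
  "space_N l n = {x. \<forall>c. c \<notin> coords l n \<longrightarrow> x c = 0}"

definition std_basis :: "nat \<Rightarrow> nat \<Rightarrow> (nat \<times> nat \<Rightarrow> int)" where
  "std_basis b i = (\<lambda>c. if c = (b, i) then 1 else 0)"

definition gen :: "(nat \<Rightarrow> nat) \<Rightarrow> nat \<Rightarrow> nat \<Rightarrow> (nat \<times> nat \<Rightarrow> int)" where
  "gen n j b = (if j \<le> n b then std_basis b j else - (\<Sum>i = 1..n b. std_basis b i))"

definition Sigma1 :: "nat \<Rightarrow> (nat \<Rightarrow> nat) \<Rightarrow> (nat \<times> nat \<Rightarrow> int) set" where
  "Sigma1 l n = {gen n j b | j b. b \<in> {1..l} \<and> j \<in> {1..n b + 1}}"

lemma Sigma1_subset_lattice_N: "Sigma1 l n \<subseteq> lattice_N l n"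
proof -
  have sum_apply: "sum f A c = (\<Sum>i\<in>A. f i c)"
    for f :: "nat \<Rightarrow> nat \<times> nat \<Rightarrow> int" and A c
    by (induction A rule: infinite_finite_induct) auto
  have "gen n j b c = 0" if "b \<in> {1..l}" "j \<in> {1..n b + 1}" "c \<notin> coords l n" for j b c
    using that by (auto simp: gen_def coords_def std_basis_def sum_apply intro!: sum.neutral)
  then show ?thesis
    by (auto simp: Sigma1_def lattice_N_def)
qed

definition ray :: "(nat \<times> nat \<Rightarrow> real) \<Rightarrow> (nat \<times> nat \<Rightarrow> int) \<Rightarrow> (nat \<times> nat \<Rightarrow> real) set" where
  "ray p v = {\<lambda>c. p c + t * of_int (v c) | t. 0 \<le> t}"

(* The tree with one vertex and m half-lines, realised as the union of the closed
   coordinate half-axes 1, ..., m, with the vertex at the origin. *)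
definition vertex :: "nat \<Rightarrow> real" where
  "vertex = (\<lambda>_. 0)"

definition edge_pt :: "nat \<Rightarrow> real \<Rightarrow> (nat \<Rightarrow> real)" where
  "edge_pt k t = (\<lambda>i. if i = k then t else 0)"

definition edge :: "nat \<Rightarrow> (nat \<Rightarrow> real) set" where
  "edge k = edge_pt k ` {0..}"

definition star :: "nat \<Rightarrow> (nat \<Rightarrow> real) set" where
  "star m = (\<Union>k\<in>{1..m}. edge k)"

definition tropical_curve ::
  "nat \<Rightarrow> (nat \<Rightarrow> nat) \<Rightarrow> nat \<Rightarrow> ((nat \<Rightarrow> real) \<Rightarrow> (nat \<times> nat \<Rightarrow> real)) \<Rightarrow> bool" where
  "tropical_curve l n m h \<longleftrightarrow>
     embedding_map (top_of_set (star m)) (top_of_set (space_N l n)) h \<and>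
     (\<exists>v. (\<forall>k\<in>{1..m}. v k \<in> Sigma1 l n \<and> h ` edge k = ray (h vertex) (v k)) \<and>
          (\<Sum>k = 1..m. v k) = 0)"

definition maslov_two_disc ::
  "nat \<Rightarrow> (nat \<Rightarrow> nat) \<Rightarrow> ((nat \<Rightarrow> real) \<Rightarrow> (nat \<times> nat \<Rightarrow> real)) \<Rightarrow> bool" where
  "maslov_two_disc l n h \<longleftrightarrow>
     embedding_map (top_of_set (star 1)) (top_of_set (space_N l n)) h \<and>
     (\<exists>v \<in> Sigma1 l n. h ` edge 1 = ray (h vertex) v)"

(* Equality of parameterized curves (and, for m = 1, of discs) up to reparametrization
   of the marked unbounded edges; values outside star m are irrelevant. *)
definition same_param ::
  "nat \<Rightarrow> ((nat \<Rightarrow> real) \<Rightarrow> (nat \<times> nat \<Rightarrow> real)) \<Rightarrow> ((nat \<Rightarrow> real) \<Rightarrow> (nat \<times> nat \<Rightarrow> real)) \<Rightarrow> bool" where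
  "same_param m h h' \<longleftrightarrow>
     (\<exists>\<phi>. homeomorphic_map (top_of_set (star m)) (top_of_set (star m)) \<phi> \<and>
          \<phi> vertex = vertex \<and> (\<forall>k\<in>{1..m}. \<phi> ` edge k = edge k) \<and>
          (\<forall>x\<in>star m. h' x = h (\<phi> x)))"

definition edge_ident :: "nat \<Rightarrow> ((nat \<Rightarrow> real) \<Rightarrow> (nat \<Rightarrow> real)) \<Rightarrow> bool" where
  "edge_ident j \<iota> \<longleftrightarrow>
     homeomorphic_map (top_of_set (star 1)) (top_of_set (edge j)) \<iota> \<and> \<iota> vertex = vertex"

lemma edge_ident_std: "edge_ident j (\<lambda>x. edge_pt j (x 1))"
proof -
  have cont: "continuous_on A (\<lambda>x. edge_pt b (x a))" for A :: "(nat \<Rightarrow> real) set" and a b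
    unfolding edge_pt_def
  proof (rule continuous_on_coordinatewise_then_product)
    have "continuous_on A (\<lambda>x. x a)"
      by (rule continuous_on_product_then_coordinatewise) (rule continuous_on_id)
    then show "continuous_on A (\<lambda>x. if i = b then x a else 0)" for i
      by (cases "i = b") auto
  qed
  have "homeomorphic_maps (top_of_set (star 1)) (top_of_set (edge j))
          (\<lambda>x. edge_pt j (x 1)) (\<lambda>x. edge_pt 1 (x j))"
    unfolding homeomorphic_maps_def continuous_map_subtopology_eu
    using cont by (auto simp: star_def edge_def) (auto simp: edge_pt_def)
  then show ?thesis
    by (auto simp: edge_ident_def homeomorphic_map_maps vertex_def edge_pt_def)
qed

(* Well-definedness (compatibility at the vertex) is the existence of such an h on star m. *)
definition is_gluing ::
  "nat \<Rightarrow> (nat \<Rightarrow> (nat \<Rightarrow> real) \<Rightarrow> (nat \<Rightarrow> real)) \<Rightarrow>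
   (nat \<Rightarrow> (nat \<Rightarrow> real) \<Rightarrow> (nat \<times> nat \<Rightarrow> real)) \<Rightarrow> ((nat \<Rightarrow> real) \<Rightarrow> (nat \<times> nat \<Rightarrow> real)) \<Rightarrow> bool" where
  "is_gluing m \<iota> disc h \<longleftrightarrow> (\<forall>j\<in>{1..m}. \<forall>x\<in>star 1. h (\<iota> j x) = disc j x)"

definition curve_at ::
  "nat \<Rightarrow> (nat \<Rightarrow> nat) \<Rightarrow> nat \<Rightarrow> (nat \<times> nat \<Rightarrow> real) \<Rightarrow> ((nat \<Rightarrow> real) \<Rightarrow> (nat \<times> nat \<Rightarrow> real)) \<Rightarrow> bool" where
  "curve_at l n a \<xi> h \<longleftrightarrow> tropical_curve l n (n a + 1) h \<and> h vertex = \<xi> \<and>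
     (\<forall>j\<in>{1..n a + 1}. h ` edge j = ray \<xi> (gen n j a))"

definition disc_at ::
  "nat \<Rightarrow> (nat \<Rightarrow> nat) \<Rightarrow> nat \<Rightarrow> nat \<Rightarrow> (nat \<times> nat \<Rightarrow> real) \<Rightarrow> ((nat \<Rightarrow> real) \<Rightarrow> (nat \<times> nat \<Rightarrow> real)) \<Rightarrow> bool" where
  "disc_at l n j a \<xi> h \<longleftrightarrow> maslov_two_disc l n h \<and> h vertex = \<xi> \<and>
     h ` edge 1 = ray \<xi> (gen n j a)"

end

theory Submission
  imports Defs
begin

text \<open>Two parameterizations with the same vertex and the same edge images differ by the
  homeomorphism $h^{-1} \circ h'$ of the star, so uniqueness is formal. Existence and the gluing
  statement rest on one fact: distinct rays $\xi + \mathbb{R}_{\ge 0} v_{j,a}$ are closed and meet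
  only in $\xi$, hence a map that is a homeomorphism from each edge onto its ray is a continuous,
  injective and closed map on the finite union of the edges, that is, an embedding.\<close>

section \<open>Edges of the star\<close>

lemma vertex_in_edge: "vertex \<in> edge k"
  unfolding edge_def by (rule image_eqI[of _ _ 0]) (auto simp: vertex_def edge_pt_def)

lemma edge_Int_edge:
  assumes "x \<in> edge j" "x \<in> edge k" "j \<noteq> k"
  shows "x = vertex"
  using assms by (fastforce simp: edge_def edge_pt_def vertex_def fun_eq_iff split: if_splits)

text \<open>Conditions on the continuous coordinate functions replace the image of a half-line;
  closedness can then be read off.\<close>

lemma edge_eq: "edge k = {x. 0 \<le> x k \<and> (\<forall>i. i \<noteq> k \<longrightarrow> x i = 0)}"
proof (intro equalityI subsetI)
  fix x :: "nat \<Rightarrow> real" assume "x \<in> {x. 0 \<le> x k \<and> (\<forall>i. i \<noteq> k \<longrightarrow> x i = 0)}"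
  then show "x \<in> edge k"
    unfolding edge_def by (intro image_eqI[of _ _ "x k"]) (auto simp: edge_pt_def)
qed (auto simp: edge_def edge_pt_def)

lemma continuous_on_eval: "continuous_on S (\<lambda>x. x i :: real)"
  by (rule continuous_on_product_then_coordinatewise[OF continuous_on_id])

lemma closed_edge: "closed (edge k)"
  unfolding edge_eq
  by (intro closed_Collect_conj closed_Collect_all closed_Collect_imp closed_Collect_le
      closed_Collect_eq continuous_on_eval continuous_intros) auto

lemma star_1: "star 1 = edge 1"
  by (auto simp: star_def)

lemma edge_subset_star: "k \<in> {1..m} \<Longrightarrow> edge k \<subseteq> star m"
  by (auto simp: star_def)

section \<open>Closed rays and their parametrization\<close>

text \<open>A coordinate \<open>c\<close> with \<open>v c \<noteq> 0\<close> determines the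
  parameter of a point on the ray, so the existential over \<open>t\<close> turns into closed
  conditions on \<open>y\<close>.\<close>

lemma ray_eq:
  assumes "v c \<noteq> 0"
  shows "ray p v = {y. 0 \<le> (y c - p c) / of_int (v c) \<and>
    (\<forall>d. y d = p d + (y c - p c) / of_int (v c) * of_int (v d))}"
proof (intro equalityI subsetI)
  fix y assume "y \<in> {y. 0 \<le> (y c - p c) / of_int (v c) \<and>
    (\<forall>d. y d = p d + (y c - p c) / of_int (v c) * of_int (v d))}"
  then show "y \<in> ray p v"
    unfolding ray_def by (auto simp: fun_eq_iff intro!: exI[of _ "(y c - p c) / of_int (v c)"])
qed (use assms in \<open>auto simp: ray_def\<close>)

lemma closed_ray:
  assumes "v c \<noteq> 0"
  shows "closed (ray p v)"
  unfolding ray_eq[of v, OF assms]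
  by (intro closed_Collect_conj closed_Collect_all closed_Collect_le closed_Collect_eq
      continuous_on_eval continuous_intros) (use assms in auto)

text \<open>The inverse recovers the parameter from coordinate \<open>c\<close> alone and is
  therefore continuous.\<close>

lemma homeomorphic_map_edge_ray:
  assumes "v c \<noteq> 0"
  shows "homeomorphic_map (top_of_set (edge k)) (top_of_set (ray p v))
    (\<lambda>x d. p d + x k * of_int (v d))"
proof -
  have "homeomorphic_maps (top_of_set (edge k)) (top_of_set (ray p v))
    (\<lambda>x d. p d + x k * of_int (v d)) (\<lambda>y. edge_pt k ((y c - p c) / of_int (v c)))"
    unfolding homeomorphic_maps_def continuous_map_subtopology_eu
  proof (intro conjI ballI)
    show "continuous_on (edge k) (\<lambda>x d. p d + x k * of_int (v d))"
      by (intro continuous_on_coordinatewise_then_product continuous_intros continuous_on_eval)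
    show "continuous_on (ray p v) (\<lambda>y. edge_pt k ((y c - p c) / of_int (v c)))"
      unfolding edge_pt_def
    proof (rule continuous_on_coordinatewise_then_product)
      show "continuous_on (ray p v) (\<lambda>y. if i = k then (y c - p c) / of_int (v c) else 0)" for i
        by (cases "i = k") (use assms in \<open>auto intro!: continuous_intros continuous_on_eval\<close>)
    qed
  qed (use assms in \<open>auto simp: edge_def ray_def edge_pt_def\<close>)
  then show ?thesis
    by (auto simp: homeomorphic_map_maps)
qed

section \<open>Embeddings of the star and their reparametrizations\<close>

text \<open>An embedding is by definition a homeomorphism onto the part of the image inside
  \<open>T\<close>; surjectivity onto that part puts the whole image in \<open>T\<close>. Afterwards
  \<open>T\<close> no longer affects the topology, so maps with equal images can be
  compared.\<close>

lemma embedding_map_top_of_set_iff: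
  "embedding_map (top_of_set S) (top_of_set T) f \<longleftrightarrow>
    f ` S \<subseteq> T \<and> homeomorphic_map (top_of_set S) (top_of_set (f ` S)) f"
proof -
  have "embedding_map (top_of_set S) (top_of_set T) f \<longleftrightarrow>
      homeomorphic_map (top_of_set S) (top_of_set (T \<inter> f ` S)) f"
    by (simp only: embedding_map_def subtopology_subtopology topspace_euclidean_subtopology)
  moreover have "f ` S \<subseteq> T" if "homeomorphic_map (top_of_set S) (top_of_set (T \<inter> f ` S)) f"
  proof -
    have "f ` S = T \<inter> f ` S"
      using homeomorphic_imp_surjective_map[OF that] by (simp only: topspace_euclidean_subtopology)
    then show ?thesis by blast
  qed
  moreover have "T \<inter> f ` S = f ` S" if "f ` S \<subseteq> T"
    using that by (rule Int_absorb1)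
  ultimately show ?thesis by metis
qed

text \<open>Continuity is pasted along the finite closed cover by edges, and the image of a closed
  set is a finite union of closed pieces, one in each \<open>R k\<close>.\<close>

lemma embedding_map_starI:
  assumes homeo: "\<And>k. k \<in> {1..m} \<Longrightarrow> homeomorphic_map (top_of_set (edge k)) (top_of_set (R k)) h"
    and closed: "\<And>k. k \<in> {1..m} \<Longrightarrow> closed (R k)"
    and subset: "\<And>k. k \<in> {1..m} \<Longrightarrow> R k \<subseteq> T"
    and meet: "\<And>j k. j \<in> {1..m} \<Longrightarrow> k \<in> {1..m} \<Longrightarrow> j \<noteq> k \<Longrightarrow> R j \<inter> R k \<subseteq> {h vertex}"
  shows "embedding_map (top_of_set (star m)) (top_of_set T) h"
proof (rule injective_closed_imp_embedding_map)
  have image: "h ` edge k = R k" if "k \<in> {1..m}" for k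
    using homeomorphic_imp_surjective_map[OF homeo[OF that]] by simp
  have inj: "inj_on h (edge k)" if "k \<in> {1..m}" for k
    using homeomorphic_imp_injective_map[OF homeo[OF that]] by simp
  have "continuous_on (edge k) h" if "k \<in> {1..m}" for k
    using homeomorphic_imp_continuous_map[OF homeo[OF that]]
    by (simp add: continuous_map_in_subtopology)
  then have "continuous_on (star m) h"
    unfolding star_def by (intro continuous_on_closed_Union closed_edge) auto
  moreover have "h ` star m \<subseteq> T"
    using image subset by (fastforce simp: star_def)
  ultimately show "continuous_map (top_of_set (star m)) (top_of_set T) h"
    by (auto simp: continuous_map_subtopology_eu)
  show "closed_map (top_of_set (star m)) (top_of_set T) h"
    unfolding closed_map_def
  proof (intro allI impI)
    fix C assume C: "closedin (top_of_set (star m)) C"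
    then obtain K where K: "closed K" "C = star m \<inter> K"
      by (auto simp: closedin_closed)
    \<comment> \<open>The homeomorphism only gives closedness relative to \<open>R k\<close>; since
      \<open>R k\<close> is closed, it becomes absolute, and finite unions can be taken.\<close>
    have "closed (h ` (edge k \<inter> K))" if k: "k \<in> {1..m}" for k
    proof -
      have "closedin (top_of_set (R k)) (h ` (edge k \<inter> K))"
        using homeomorphic_imp_closed_map[OF homeo[OF k]] K(1)
        by (auto simp: closed_map_def closedin_closed_Int)
      then show ?thesis
        using closed[OF k] closedin_closed_trans by blast
    qed
    then have "closed (\<Union>k\<in>{1..m}. h ` (edge k \<inter> K))"
      by blast
    moreover have "h ` C = (\<Union>k\<in>{1..m}. h ` (edge k \<inter> K))"
      using K(2) by (auto simp: star_def)
    ultimately show "closedin (top_of_set T) (h ` C)"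
      using \<open>h ` star m \<subseteq> T\<close> K(2) by (intro closed_subset) auto
  qed
  have "x = y" if "j \<in> {1..m}" "k \<in> {1..m}" "x \<in> edge j" "y \<in> edge k" "h x = h y" for j k x y
  proof (cases "j = k")
    case False
    \<comment> \<open>The common value lies in both \<open>R j\<close> and \<open>R k\<close>. As
      the vertex belongs to both edges, injectivity on each of them then forces \<open>x\<close> and
      \<open>y\<close> to be the vertex.\<close>
    then have "h x = h vertex"
      using meet[OF that(1,2)] image[OF that(1)] image[OF that(2)] that by blast
    then have "x = vertex" "y = vertex"
      using inj[OF that(1)] inj[OF that(2)] that vertex_in_edge by (auto dest: inj_onD)
    then show ?thesis by simp
  qed (use that inj in \<open>auto dest: inj_onD\<close>)
  then show "inj_on h (topspace (top_of_set (star m)))"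
    by (auto simp: inj_on_def star_def)
qed

text \<open>Serves curves and, with \<open>m = 1\<close>, discs. The bound \<open>1 \<le> m\<close>
  puts the vertex into the star, which is empty for \<open>m = 0\<close>.\<close>

lemma same_param_of_images_eq:
  assumes "1 \<le> m"
    and emb: "embedding_map (top_of_set (star m)) (top_of_set T) h"
      "embedding_map (top_of_set (star m)) (top_of_set T) h'"
    and vertex_eq: "h vertex = h' vertex"
    and image_eq: "\<And>k. k \<in> {1..m} \<Longrightarrow> h ` edge k = h' ` edge k"
  shows "same_param m h h'"
proof -
  have images: "h ` star m = h' ` star m"
    using image_eq by (simp add: star_def image_UN)
  have homeo: "homeomorphic_map (top_of_set (star m)) (top_of_set (h ` star m)) h"
    "homeomorphic_map (top_of_set (star m)) (top_of_set (h ` star m)) h'"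
    using emb by (auto simp: embedding_map_top_of_set_iff images)
  \<comment> \<open>\<open>g\<close> inverts \<open>h\<close> on the common image; the
    reparametrization will be \<open>g \<circ> h'\<close>.\<close>
  obtain g where g: "homeomorphic_maps (top_of_set (star m)) (top_of_set (h ` star m)) h g"
    using homeo(1) by (auto simp: homeomorphic_map_maps)
  have gh: "g (h x) = x" if "x \<in> star m" for x
    using g that by (auto simp: homeomorphic_maps_def)
  have hg: "h (g y) = y" if "y \<in> h ` star m" for y
    using g that by (auto simp: homeomorphic_maps_def)
  have "homeomorphic_map (top_of_set (star m)) (top_of_set (star m)) (g \<circ> h')"
    using homeo(2) g homeomorphic_map_compose homeomorphic_maps_map by blast
  moreover have "(g \<circ> h') vertex = vertex"
    using gh[of vertex] vertex_eq vertex_in_edge[of 1] edge_subset_star[of 1 m] assms(1) by auto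
  moreover have "(g \<circ> h') ` edge k = edge k" if "k \<in> {1..m}" for k
  proof -
    have "(g \<circ> h') ` edge k = g ` h ` edge k"
      using image_eq[OF that] by (simp add: image_comp)
    also have "\<dots> = edge k"
      using gh edge_subset_star[OF that] by (force simp: image_image)
    finally show ?thesis .
  qed
  moreover have "h' x = h ((g \<circ> h') x)" if "x \<in> star m" for x
    using hg[of "h' x"] that images by auto
  ultimately show ?thesis
    unfolding same_param_def by blast
qed

section \<open>Well-definedness of the gluing\<close>

text \<open>Distinct edges share only the vertex, and there all discs take the same value
  \<open>p\<close>, so the prescribed values are compatible.\<close>

lemma gluing_exists:
  assumes ident: "\<And>j. j \<in> {1..m} \<Longrightarrow> edge_ident j (\<iota> j)"
    and vertices: "\<And>j. j \<in> {1..m} \<Longrightarrow> disc j vertex = p"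
  shows "\<exists>h. is_gluing m \<iota> disc h"
proof -
  \<comment> \<open>Any value prescribed at \<open>y\<close> by some disc is chosen;
    \<open>disc_eq\<close> shows that there is at most one. Off the star the value is
    arbitrary.\<close>
  define h where
    "h y = (SOME z. \<exists>j\<in>{1..m}. \<exists>x\<in>star 1. \<iota> j x = y \<and> z = disc j x)" for y
  have inj: "inj_on (\<iota> j) (star 1)" and image: "\<iota> j ` star 1 = edge j" and "\<iota> j vertex = vertex"
    if "j \<in> {1..m}" for j
    using ident[OF that] homeomorphic_imp_injective_map homeomorphic_imp_surjective_map
    unfolding edge_ident_def by fastforce+
  have disc_eq: "disc j x = disc k y"
    if "j \<in> {1..m}" "k \<in> {1..m}" "x \<in> star 1" "y \<in> star 1" "\<iota> j x = \<iota> k y" for j k x y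
  proof (cases "j = k")
    case True
    then show ?thesis
      using inj that by (auto dest: inj_onD)
  next
    case False
    then have "\<iota> j x = vertex" "\<iota> k y = vertex"
      using edge_Int_edge[of "\<iota> j x" j k] imageI[OF that(3), of "\<iota> j"] imageI[OF that(4), of "\<iota> k"]
        image[OF that(1)] image[OF that(2)] that(5) by simp_all
    moreover have "vertex \<in> star 1"
      by (simp only: star_1 vertex_in_edge)
    \<comment> \<open>Each identification is injective and fixes the vertex, so nothing else in
      \<open>star 1\<close> is sent to the vertex.\<close>
    ultimately have "x = vertex" "y = vertex"
      using inj[OF that(1)] inj[OF that(2)] that \<open>\<And>j. j \<in> {1..m} \<Longrightarrow> \<iota> j vertex = vertex\<close>
      by (metis inj_onD)+
    then show ?thesis
      using vertices that by simp
  qed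
  have "h (\<iota> j x) = disc j x" if "j \<in> {1..m}" "x \<in> star 1" for j x
    unfolding h_def by (rule some_equality) (use that disc_eq in blast)+
  then show ?thesis
    unfolding is_gluing_def by blast
qed

section \<open>Generators of the fan\<close>

lemma gen_apply:
  "gen n j b c = (if j \<le> n b then if c = (b, j) then 1 else 0
     else if c \<in> {b} \<times> {1..n b} then - 1 else 0)"
proof -
  have "(\<Sum>i\<in>A. std_basis b i) c = (if c \<in> {b} \<times> A then 1 else 0)" if "finite A" for A
    using that by (induction A) (auto simp: std_basis_def)
  then show ?thesis
    by (auto simp: gen_def std_basis_def)
qed

text \<open>This is the balancing condition: the last generator is minus the sum of the
  others.\<close>

lemma sum_gen: "(\<Sum>j = 1..n b + 1. gen n j b) = 0"
  by (simp add: gen_def)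

text \<open>For \<open>n b = 0\<close> the generator with \<open>j = 1\<close> is an empty sum,
  hence zero, and its ray degenerates to a point.\<close>

lemma gen_nonzero:
  assumes "1 \<le> n b"
  shows "\<exists>c. gen n j b c \<noteq> 0"
proof (cases "j \<le> n b")
  case True
  then show ?thesis by (intro exI[of _ "(b, j)"]) (simp add: gen_apply)
next
  case False
  then show ?thesis using assms by (intro exI[of _ "(b, 1)"]) (simp add: gen_apply)
qed

lemma gen_in_Sigma1: "b \<in> {1..l} \<Longrightarrow> j \<in> {1..n b + 1} \<Longrightarrow> gen n j b \<in> Sigma1 l n"
  by (auto simp: Sigma1_def)

text \<open>For \<open>j < k\<close>, coordinate \<open>(b, j)\<close> separates the rays: it does
  not decrease along the first and does not increase along the second, so a common point has
  parameter zero on the first.\<close>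

lemma ray_gen_Int:
  assumes "j \<in> {1..n b + 1}" "k \<in> {1..n b + 1}" "j \<noteq> k"
  shows "ray p (gen n j b) \<inter> ray p (gen n k b) \<subseteq> {p}"
  using assms
proof (induction j k rule: linorder_wlog)
  case (le j k)
  \<comment> \<open>From \<open>j < k\<close> and \<open>k \<le> n b + 1\<close>: the smaller index
    never belongs to the last generator.\<close>
  then have j: "j \<le> n b" by auto
  show ?case
  proof
    fix y assume "y \<in> ray p (gen n j b) \<inter> ray p (gen n k b)"
    then obtain s t where "0 \<le> s" "0 \<le> t"
      and s: "y = (\<lambda>c. p c + s * of_int (gen n j b c))"
      and t: "y = (\<lambda>c. p c + t * of_int (gen n k b c))"
      by (auto simp: ray_def)
    have "gen n j b (b, j) = 1" "gen n k b (b, j) \<le> 0"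
      using j le by (auto simp: gen_apply)
    moreover have "s * of_int (gen n j b (b, j)) = t * of_int (gen n k b (b, j))"
      using fun_cong[OF s, of "(b, j)"] fun_cong[OF t, of "(b, j)"] by simp
    ultimately have "s \<le> 0"
      using \<open>0 \<le> t\<close> by (simp add: mult_nonneg_nonpos)
    then show "y \<in> {p}"
      using \<open>0 \<le> s\<close> s by simp
  qed
next
  case (sym j k)
  then show ?case by (simp add: Int_commute)
qed

lemma ray_subset_space_N:
  assumes "p \<in> space_N l n" "v \<in> Sigma1 l n"
  shows "ray p v \<subseteq> space_N l n"
  using assms Sigma1_subset_lattice_N[of l n] by (auto simp: ray_def space_N_def lattice_N_def)

section \<open>Discs, glued curves and uniqueness\<close>

lemma disc_at_exists:
  assumes "1 \<le> n b" "b \<in> {1..l}" "j \<in> {1..n b + 1}" "p \<in> space_N l n"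
  shows "\<exists>h. disc_at l n j b p h"
proof -
  \<comment> \<open>The affine parametrization of the ray; coordinate 1 of \<open>x\<close> is the
    parameter along the single edge of \<open>star 1\<close>.\<close>
  define h where "h x d = p d + x 1 * of_int (gen n j b d)" for x :: "nat \<Rightarrow> real" and d
  obtain c where "gen n j b c \<noteq> 0"
    using gen_nonzero[of n b j] assms(1) by blast
  then have homeo: "homeomorphic_map (top_of_set (edge 1)) (top_of_set (ray p (gen n j b))) h"
    unfolding h_def by (rule homeomorphic_map_edge_ray)
  then have image: "h ` edge 1 = ray p (gen n j b)"
    using homeomorphic_imp_surjective_map by fastforce
  have "gen n j b \<in> Sigma1 l n"
    using assms(2,3) by (rule gen_in_Sigma1)
  moreover have "h vertex = p"
    by (auto simp: h_def vertex_def)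
  ultimately have "disc_at l n j b p h"
    using homeo image ray_subset_space_N[of p l n "gen n j b"] assms(4)
    unfolding disc_at_def maslov_two_disc_def star_1 embedding_map_top_of_set_iff by auto
  then show ?thesis by blast
qed

text \<open>On edge \<open>j\<close> the glued map is \<open>disc j\<close> after the inverse of
  \<open>\<iota> j\<close>, hence a homeomorphism onto the ray, as
  \<open>embedding_map_starI\<close> requires. Concluding \<open>curve_at\<close>, not just
  \<open>tropical_curve\<close>, makes the uniqueness result applicable to the glued map.\<close>

lemma curve_at_gluing:
  assumes "1 \<le> n b" "b \<in> {1..l}" "p \<in> space_N l n"
    and disc: "\<And>j. j \<in> {1..n b + 1} \<Longrightarrow> disc_at l n j b p (disc j)"
    and ident: "\<And>j. j \<in> {1..n b + 1} \<Longrightarrow> edge_ident j (\<iota> j)"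
    and glue: "is_gluing (n b + 1) \<iota> disc h"
  shows "curve_at l n b p h"
proof -
  have vertex: "h vertex = p"
  proof -
    have "h (\<iota> 1 vertex) = disc 1 vertex"
      using glue vertex_in_edge[of 1] unfolding is_gluing_def star_1 by auto
    then show ?thesis
      using ident[of 1] disc[of 1] by (auto simp: edge_ident_def disc_at_def)
  qed
  have homeo: "homeomorphic_map (top_of_set (edge j)) (top_of_set (ray p (gen n j b))) h"
    if j: "j \<in> {1..n b + 1}" for j
  proof -
    obtain \<kappa> where \<kappa>: "homeomorphic_maps (top_of_set (star 1)) (top_of_set (edge j)) (\<iota> j) \<kappa>"
      using ident[OF j] by (auto simp: edge_ident_def homeomorphic_map_maps)
    have "homeomorphic_map (top_of_set (star 1)) (top_of_set (ray p (gen n j b))) (disc j)"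
      using disc[OF j] unfolding disc_at_def maslov_two_disc_def embedding_map_top_of_set_iff star_1
      by auto
    then have "homeomorphic_map (top_of_set (edge j)) (top_of_set (ray p (gen n j b))) (disc j \<circ> \<kappa>)"
      using \<kappa> homeomorphic_map_compose homeomorphic_maps_map by blast
    moreover have "(disc j \<circ> \<kappa>) y = h y" if "y \<in> edge j" for y
    proof -
      have "\<kappa> y \<in> star 1" "\<iota> j (\<kappa> y) = y"
        using \<kappa> that by (auto simp: homeomorphic_maps_def continuous_map_def)
      then show ?thesis
        using glue j unfolding is_gluing_def o_apply by (metis (no_types))
    qed
    ultimately show ?thesis
      by (rule homeomorphic_map_eq) simp
  qed
  have gens: "gen n j b \<in> Sigma1 l n" if "j \<in> {1..n b + 1}" for j
    using assms(2) that by (rule gen_in_Sigma1)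
  have "embedding_map (top_of_set (star (n b + 1))) (top_of_set (space_N l n)) h"
  proof (rule embedding_map_starI)
    show "closed (ray p (gen n j b))" for j
      using gen_nonzero[of n b j] assms(1) closed_ray by blast
    show "ray p (gen n j b) \<inter> ray p (gen n k b) \<subseteq> {h vertex}"
      if "j \<in> {1..n b + 1}" "k \<in> {1..n b + 1}" "j \<noteq> k" for j k
      using ray_gen_Int[of j n b k p] that vertex by simp
  qed (use homeo ray_subset_space_N assms(3) gens in auto)
  moreover have "h ` edge j = ray p (gen n j b)" if "j \<in> {1..n b + 1}" for j
    using homeomorphic_imp_surjective_map[OF homeo[OF that]] by simp
  ultimately show ?thesis
    unfolding curve_at_def tropical_curve_def using vertex gens sum_gen[of n b]
    by (intro conjI exI[of _ "\<lambda>j. gen n j b"]) auto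
qed

lemma curve_at_unique:
  assumes "curve_at l n b p h" "curve_at l n b p h'"
  shows "same_param (n b + 1) h h'"
proof (rule same_param_of_images_eq)
  show "embedding_map (top_of_set (star (n b + 1))) (top_of_set (space_N l n)) h"
    "embedding_map (top_of_set (star (n b + 1))) (top_of_set (space_N l n)) h'"
    using assms by (simp_all only: curve_at_def tropical_curve_def)
qed (use assms in \<open>simp_all add: curve_at_def\<close>)

lemma disc_at_unique:
  assumes "disc_at l n j b p h" "disc_at l n j b p h'"
  shows "same_param 1 h h'"
proof (rule same_param_of_images_eq)
  show "embedding_map (top_of_set (star 1)) (top_of_set (space_N l n)) h"
    "embedding_map (top_of_set (star 1)) (top_of_set (space_N l n)) h'"
    using assms by (simp_all only: disc_at_def maslov_two_disc_def)
  show "h ` edge k = h' ` edge k" if "k \<in> {1..1}" for k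
    using assms that by (auto simp: disc_at_def)
qed (use assms in \<open>simp_all add: disc_at_def\<close>)

theorem proposition2p3:
  fixes l a :: nat and n :: "nat \<Rightarrow> nat" and \<xi> :: "nat \<times> nat \<Rightarrow> real"
  assumes "\<forall>b\<in>{1..l}. 1 \<le> n b"
    and "1 \<le> a" and "a \<le> l"
    and "\<xi> \<in> space_N l n"
  shows "(\<exists>h. curve_at l n a \<xi> h) \<and>
    (\<forall>h h'. curve_at l n a \<xi> h \<and> curve_at l n a \<xi> h' \<longrightarrow> same_param (n a + 1) h h') \<and>
    (\<forall>j\<in>{1..n a + 1}. (\<exists>h. disc_at l n j a \<xi> h) \<and>
       (\<forall>h h'. disc_at l n j a \<xi> h \<and> disc_at l n j a \<xi> h' \<longrightarrow> same_param 1 h h')) \<and>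
    (\<forall>disc \<iota>. (\<forall>j\<in>{1..n a + 1}. disc_at l n j a \<xi> (disc j) \<and> edge_ident j (\<iota> j)) \<longrightarrow>
       (\<exists>h. is_gluing (n a + 1) \<iota> disc h) \<and>
       (\<forall>h. is_gluing (n a + 1) \<iota> disc h \<longrightarrow>
          tropical_curve l n (n a + 1) h \<and>
          (\<forall>h\<^sub>a. curve_at l n a \<xi> h\<^sub>a \<longrightarrow> same_param (n a + 1) h h\<^sub>a)))"
proof -
  let ?J = "{1..n a + 1}"
  have a: "a \<in> {1..l}" "1 \<le> n a"
    using assms by auto
  have discs: "\<exists>h. disc_at l n j a \<xi> h" if "j \<in> ?J" for j
    using a that assms(4) by (intro disc_at_exists)
  have glue_exists: "\<exists>h. is_gluing (n a + 1) \<iota> disc h"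
    if "\<forall>j\<in>?J. disc_at l n j a \<xi> (disc j) \<and> edge_ident j (\<iota> j)" for disc \<iota>
    using that by (intro gluing_exists[where p = \<xi>]) (auto simp: disc_at_def)
  have glue_curve: "curve_at l n a \<xi> h"
    if "\<forall>j\<in>?J. disc_at l n j a \<xi> (disc j) \<and> edge_ident j (\<iota> j)"
      "is_gluing (n a + 1) \<iota> disc h" for disc \<iota> h
    using that a assms(4) by (intro curve_at_gluing[of n a l \<xi> disc \<iota> h]) auto
  \<comment> \<open>Existence of the curve is itself obtained by gluing: discs are chosen and
    attached along the standard identifications.\<close>
  obtain disc where disc: "\<forall>j\<in>?J. disc_at l n j a \<xi> (disc j)"
    using discs by metis
  have std: "\<forall>j\<in>?J. disc_at l n j a \<xi> (disc j) \<and> edge_ident j (\<lambda>x. edge_pt j (x 1))"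
    using disc edge_ident_std by blast
  show ?thesis
  proof (intro conjI allI impI ballI)
    show "\<exists>h. curve_at l n a \<xi> h"
      using glue_exists[OF std] glue_curve[OF std] by blast
  next
    fix disc \<iota> h
    assume *: "\<forall>j\<in>?J. disc_at l n j a \<xi> (disc j) \<and> edge_ident j (\<iota> j)"
      "is_gluing (n a + 1) \<iota> disc h"
    show "tropical_curve l n (n a + 1) h"
      using glue_curve[OF *] by (simp add: curve_at_def)
    \<comment> \<open>The glued map has the prescribed vertex and edge images, so coincidence with
      \<open>h\<^sub>a\<close> is an instance of uniqueness.\<close>
    show "same_param (n a + 1) h h\<^sub>a" if "curve_at l n a \<xi> h\<^sub>a" for h\<^sub>a
      using curve_at_unique[OF glue_curve[OF *] that] .
  qed (use discs glue_exists in \<open>auto intro: curve_at_unique disc_at_unique simp del: One_nat_def\<close>)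
qed

end
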